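(* For every prime $p\ge 5$, there is a coloring of $\mathbb{Z}/p^4\mathbb{Z}$ using at most $27p$ colors with no nontrivial symmetrically colored $4$-term arithmetic progressions.
   Context: An $r$-coloring of a set is a map from it to a set of at most $r$ colors. A $4$-term arithmetic progression in an abelian group $G$ is a sequence $a, a+d, a+2d, a+3d$ with $a,d\in G$; it is nontrivial if $d\neq 0$ in $G$. Given a coloring $c$ of $G$, it is symmetrically colored if $c(a)=c(a+3d)$ and $c(a+d)=c(a+2d)$. *)

theory Defs
  imports
    "HOL-Algebra.Elementary_Groups"
    "HOL-Computational_Algebra.Primes"
    "HOL-Library.FuncSet"
begin

definition coloring :: "nat \<Rightarrow> 'a set \<Rightarrow> ('a \<Rightarrow> 'c) \<Rightarrow> bool"
  where "coloring r S c \<longleftrightarrow> (\<exists>C. finite C \<and> card C \<le> r \<and> c \<in> S \<rightarrow> C)"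

text \<open>Abelian groups are those of HOL-Algebra, which are written multiplicatively: the term
  \<open>a + i d\<close> of a progression is \<open>a \<otimes> d [^] i\<close>, and the condition \<open>d \<noteq> 0\<close> is \<open>d \<noteq> \<one>\<close>.
  A progression is represented by the pair of its first term and its common difference.\<close>

definition ap_term :: "('a, 'b) monoid_scheme \<Rightarrow> 'a \<Rightarrow> 'a \<Rightarrow> nat \<Rightarrow> 'a"
  where "ap_term G a d i = a \<otimes>\<^bsub>G\<^esub> d [^]\<^bsub>G\<^esub> i"

definition nontrivial_ap :: "('a, 'b) monoid_scheme \<Rightarrow> 'a \<Rightarrow> 'a \<Rightarrow> bool"
  where "nontrivial_ap G a d \<longleftrightarrow> a \<in> carrier G \<and> d \<in> carrier G \<and> d \<noteq> \<one>\<^bsub>G\<^esub>"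

definition symmetrically_colored ::
    "('a, 'b) monoid_scheme \<Rightarrow> ('a \<Rightarrow> 'c) \<Rightarrow> 'a \<Rightarrow> 'a \<Rightarrow> bool"
  where "symmetrically_colored G c a d \<longleftrightarrow>
    c (ap_term G a d 0) = c (ap_term G a d 3) \<and> c (ap_term G a d 1) = c (ap_term G a d 2)"

end

theory Submission
  imports Defs "HOL-Number_Theory.Cong"
begin

text \<open>Write the elements of \<open>\<int>/p\<^sup>4\<int>\<close> in base \<open>p\<close> and color \<open>x = (x\<^sub>0, x\<^sub>1, x\<^sub>2, x\<^sub>3)\<close> by
  \<open>N(x\<^sub>0, x\<^sub>1, x\<^sub>2) + x\<^sub>3 mod p\<close>, where \<open>N\<close> is the norm form of a cubic field extension of \<open>\<int>/p\<int>\<close>,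
  together with the third of \<open>[0, p)\<close> in which each of \<open>x\<^sub>0, x\<^sub>1, x\<^sub>2\<close> lies. The thirds force the
  digits of a symmetrically colored progression to form progressions in \<open>\<int>\<close>, without carries, so
  that digitwise it becomes a progression in \<open>(\<int>/p\<int>)\<^sup>4\<close>. The combination
  \<open>f(a + 3d) - 3 f(a + 2d) + 3 f(a + d) - f(a)\<close> vanishes by symmetry, and equals \<open>6 N(d\<^sub>0, d\<^sub>1, d\<^sub>2)\<close>
  because \<open>N\<close> is a cubic form. As \<open>N\<close> is anisotropic, \<open>d\<^sub>0 = d\<^sub>1 = d\<^sub>2 = 0\<close>; then
  \<open>f(a + 2d) - f(a + d) = d\<^sub>3\<close> vanishes as well.\<close>

lemma div_less_iff_less_mult_int:
  fixes q :: int
  assumes "q > 0"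
  shows "x div q < m \<longleftrightarrow> x < m * q"
  using pos_imp_zdiv_neg_iff[of q "x + - m * q"] div_mult_self1[of q x "- m"] assms by auto

section \<open>An anisotropic cubic form modulo \<open>p\<close>\<close>

text \<open>The map \<open>t ^ 3 - t\<close> agrees at 0 and 1, so on the finite set of residues it
  is not injective, hence not surjective; any missed value serves as \<open>c\<close>. A cubic
  without a root is irreducible, which yields the field extension.\<close>

lemma exists_cubic_without_root_mod:
  fixes p :: int
  assumes "p > 1"
  shows "\<exists>c. \<forall>t. \<not> p dvd t ^ 3 - t - c"
proof -
  define g where "g t = (t ^ 3 - t) mod p" for t
  have "g 0 = g 1" by (simp add: g_def)
  then have "\<not> inj_on g {0..<p}"
    using assms inj_onD[of g "{0..<p}" 0 1] by auto
  moreover have "g ` {0..<p} \<subseteq> {0..<p}"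
    using assms by (auto simp: g_def)
  ultimately have "g ` {0..<p} \<noteq> {0..<p}"
    using eq_card_imp_inj_on[of "{0..<p}" g] by auto
  with \<open>g ` {0..<p} \<subseteq> {0..<p}\<close> obtain c where c: "c \<in> {0..<p}" "c \<notin> g ` {0..<p}"
    by blast
  have "\<not> p dvd t ^ 3 - t - c" for t
  proof
    assume "p dvd t ^ 3 - t - c"
    then have "(t ^ 3 - t) mod p = c"
      using c(1) by (simp add: mod_eq_dvd_iff[symmetric])
    moreover have "g (t mod p) = (t ^ 3 - t) mod p"
      unfolding g_def by (intro cong_diff[unfolded cong_def] cong_pow[unfolded cong_def]) simp_all
    ultimately have "g (t mod p) = c" by simp
    moreover have "t mod p \<in> {0..<p}" using assms by simp
    ultimately show False
      using c(2) by blast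
  qed
  then show ?thesis by blast
qed

text \<open>The norm of \<open>x + y\<theta> + z\<theta>\<^sup>2\<close>, where \<open>\<theta>\<^sup>3 = \<theta> + c\<close>: the determinant of multiplication by this
  element in the basis \<open>1, \<theta>, \<theta>\<^sup>2\<close>.\<close>

definition cubic_norm :: "int \<Rightarrow> int \<Rightarrow> int \<Rightarrow> int \<Rightarrow> int"
  where "cubic_norm c x y z =
    x * ((x + z) * (x + z) - y * (c * z + y)) - c * z * (y * (x + z) - z * (c * z + y))
    + c * y * (y * y - z * (x + z))"

text \<open>If \<open>y\<close> were invertible modulo \<open>p\<close>, then \<open>-x/y\<close>
  would be a root of \<open>t ^ 3 - t - c\<close>, since the norm is \<open>- (y ^ 3)\<close> times
  the value of this cubic there.\<close>

lemma cubic_norm_linear_anisotropic: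
  fixes p :: int
  assumes p: "prime p" and c: "\<And>t. \<not> p dvd t ^ 3 - t - c"
    and dvd: "p dvd cubic_norm c x y 0"
  shows "p dvd x \<and> p dvd y"
proof -
  have norm: "cubic_norm c x y 0 = x ^ 3 - x * y ^ 2 + c * y ^ 3"
    by (simp add: cubic_norm_def algebra_simps power2_eq_square power3_eq_cube)
  have "p dvd y"
  proof (rule ccontr)
    assume "\<not> p dvd y"
    then have "coprime y p"
      using p by (metis prime_imp_coprime coprime_commute)
    then obtain w where "[y * w = 1] (mod p)"
      using cong_solve_coprime_int by blast
    then obtain k where k: "y * w = 1 + p * k"
      by (metis add.commute cong_iff_lin cong_sym mult.commute)
    \<comment> \<open>The cubic at \<open>- (x * w)\<close> is homogenized: each factor 1 is written
      out so that it can be replaced by \<open>y * w\<close>.\<close>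
    have "[(- (x * w)) ^ 3 - (- (x * w)) * (1 * 1) - c * (1 * 1 * 1)
        = (- (x * w)) ^ 3 - (- (x * w)) * ((y * w) * (y * w)) - c * ((y * w) * (y * w) * (y * w))]
        (mod p)"
      using \<open>[y * w = 1] (mod p)\<close> by (intro cong_diff cong_mult cong_refl) (auto intro: cong_sym)
    also have "(- (x * w)) ^ 3 - (- (x * w)) * ((y * w) * (y * w)) - c * ((y * w) * (y * w) * (y * w))
        = - (w ^ 3) * cubic_norm c x y 0"
      unfolding norm by (simp add: algebra_simps power2_eq_square power3_eq_cube)
    also have "[\<dots> = 0] (mod p)"
      using dvd by (simp add: cong_0_iff)
    finally show False
      using c[of "- (x * w)"] by (simp add: cong_0_iff)
  qed
  then have "p dvd x ^ 3"
    using dvd dvd_add[of p "x ^ 3 - x * y ^ 2 + c * y ^ 3" "y * (x * y - c * y ^ 2)"] unfolding norm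
    by (simp add: algebra_simps power2_eq_square power3_eq_cube)
  with \<open>p dvd y\<close> p show ?thesis
    using prime_dvd_power by blast
qed

text \<open>Multiplying \<open>x + y\<theta> + z\<theta>\<^sup>2\<close> by \<open>z\<theta> - y\<close> cancels the quadratic term and so reduces the claim to
  the norm of linear elements.\<close>

lemma cubic_norm_anisotropic:
  fixes p :: int
  assumes p: "prime p" and c: "\<And>t. \<not> p dvd t ^ 3 - t - c"
    and dvd: "p dvd cubic_norm c x y z"
  shows "p dvd x \<and> p dvd y \<and> p dvd z"
proof -
  \<comment> \<open>The product of \<open>x + y\<theta> + z\<theta>^2\<close> and
    \<open>z\<theta> - y\<close> is \<open>v + u\<theta>\<close>.\<close>
  define u v where "u = z * z + z * x - y * y" and "v = c * z * z - x * y"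
  have "cubic_norm c v u 0 = cubic_norm c x y z * cubic_norm c (- y) z 0"
    unfolding u_def v_def cubic_norm_def by algebra
  with dvd have "p dvd cubic_norm c v u 0" by simp
  then have uv: "p dvd v" "p dvd u"
    using cubic_norm_linear_anisotropic[OF p c] by blast+
  \<comment> \<open>Divisibility of \<open>u\<close> and \<open>v\<close> thus passes to the norm of
    \<open>z\<theta> - y\<close>, and the linear case applies a second time.\<close>
  have "cubic_norm c (- y) z 0 = z * v + y * u"
    unfolding u_def v_def cubic_norm_def by algebra
  with uv have "p dvd cubic_norm c (- y) z 0" by simp
  then have yz: "p dvd y" "p dvd z"
    using cubic_norm_linear_anisotropic[OF p c, of "- y" z] by auto
  have "cubic_norm c x y z = x ^ 3 + y * (c * (y * y - z * (x + z)) - x * (c * z + y))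
      + z * (x * (2 * x + z) - c * (y * (x + z) - z * (c * z + y)))"
    unfolding cubic_norm_def by algebra
  with dvd yz have "p dvd x ^ 3"
    by (metis dvd_add_left_iff dvd_mult2)
  with p yz show ?thesis
    using prime_dvd_power by blast
qed

text \<open>Along a line, a cubic form is a cubic polynomial whose leading coefficient is the value
  of the form at the direction; its third difference is 3! times that coefficient.\<close>

lemma cubic_norm_third_difference:
  "cubic_norm c (x + 3 * r) (y + 3 * s) (z + 3 * t) - cubic_norm c x y z
    - 3 * (cubic_norm c (x + 2 * r) (y + 2 * s) (z + 2 * t) - cubic_norm c (x + r) (y + s) (z + t))
    = 6 * cubic_norm c r s t"
  unfolding cubic_norm_def by algebra

lemma cubic_norm_cong:
  assumes "[x = x'] (mod p)" "[y = y'] (mod p)" "[z = z'] (mod p)"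
  shows "[cubic_norm c x y z = cubic_norm c x' y' z'] (mod p)"
  unfolding cubic_norm_def using assms
  by (intro cong_add cong_diff cong_mult cong_refl)

section \<open>Base-\<open>p\<close> digits of progressions without carries\<close>

text \<open>Let the two second differences be \<open>p * k\<close> and \<open>p * l\<close>. As
  \<open>b\<close> and \<open>c\<close> differ by less than \<open>p/3\<close>, \<open>k = 1\<close>
  puts \<open>a\<close> more than \<open>2p/3\<close> above \<open>b\<close>. So \<open>a\<close>,
  \<open>d\<close> lie in the top third and \<open>b\<close>, \<open>c\<close> in the bottom one,
  which forces \<open>l = 1\<close>. Then \<open>a + d - (b + c) = 2 * p\<close>, impossible for
  residues. The other cases are mirror images.\<close>

lemma equal_thirds_no_carry:
  fixes p :: int
  assumes range: "a \<in> {0..<p}" "b \<in> {0..<p}" "c \<in> {0..<p}" "d \<in> {0..<p}"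
    and ap: "p dvd a - 2 * b + c" "p dvd b - 2 * c + d"
    and thirds: "3 * a div p = 3 * d div p" "3 * b div p = 3 * c div p"
  shows "a - 2 * b + c = 0 \<and> b - 2 * c + d = 0"
proof -
  have p: "p > 0" using range by auto
  have third: "3 * x div p \<in> {0, 1, 2} \<and> p * (3 * x div p) \<le> 3 * x \<and> 3 * x < p * (3 * x div p) + p"
    if "x \<in> {0..<p}" for x
  proof -
    have "p * (3 * x div p) + 3 * x mod p = 3 * x" by simp
    moreover have "0 \<le> 3 * x mod p" "3 * x mod p < p" using p by auto
    moreover have "0 \<le> 3 * x div p" using that p by (simp add: pos_imp_zdiv_nonneg_iff)
    moreover have "3 * x div p < 3"
      using that p by (simp add: div_less_iff_less_mult_int)
    moreover from calculation(4,5) have "3 * x div p \<in> {0, 1, 2}" by auto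
    ultimately show ?thesis by - (intro conjI; (assumption | linarith))
  qed
  define s t where "s = 3 * a div p" and "t = 3 * b div p"
  have s: "s \<in> {0, 1, 2}" "p * s \<le> 3 * a" "3 * a < p * s + p" "p * s \<le> 3 * d" "3 * d < p * s + p"
    using third[OF range(1)] third[OF range(4)] thirds unfolding s_def by auto
  have t: "t \<in> {0, 1, 2}" "p * t \<le> 3 * b" "3 * b < p * t + p" "p * t \<le> 3 * c" "3 * c < p * t + p"
    using third[OF range(2)] third[OF range(3)] thirds unfolding t_def by auto
  obtain k where k: "a - 2 * b + c = p * k" using ap(1) by (elim dvdE)
  obtain l where l: "b - 2 * c + d = p * l" using ap(2) by (elim dvdE)
  have bound: "m \<in> {-1, 0, 1}" if "e = p * m" "- (2 * p) < e" "e < 2 * p" for e m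
  proof -
    have "p * (-2) < p * m" "p * m < p * 2" using that by linarith+
    then have "-2 < m" "m < 2" by (simp_all only: mult_less_cancel_left_pos[OF p])
    then show ?thesis by auto
  qed
  have "k \<in> {-1, 0, 1}" "l \<in> {-1, 0, 1}"
    using bound[OF k] bound[OF l] range by auto
  with s t k l range show ?thesis by auto
qed

definition digit :: "int \<Rightarrow> nat \<Rightarrow> int \<Rightarrow> int"
  where "digit p i x = x div p ^ i mod p"

lemma digits_eq_imp_eq:
  fixes p :: int
  assumes "p > 0" "x \<in> {0..<p ^ n}" "y \<in> {0..<p ^ n}" "\<And>i. i < n \<Longrightarrow> digit p i x = digit p i y"
  shows "x = y"
  using assms(2-4)
proof (induction n arbitrary: x y)
  case (Suc n)
  have "z div p \<in> {0..<p ^ n}" if "z \<in> {0..<p ^ Suc n}" for z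
    using that assms(1) by (auto simp: div_less_iff_less_mult_int pos_imp_zdiv_nonneg_iff mult.commute)
  moreover have "digit p i (x div p) = digit p i (y div p)" if "i < n" for i
    using Suc.prems(3)[of "Suc i"] that assms(1)
    by (simp add: digit_def zdiv_zmult2_eq)
  ultimately have "x div p = y div p"
    using Suc by blast
  moreover have "x mod p = y mod p"
    using Suc.prems(3)[of 0] by (simp add: digit_def)
  ultimately show ?case
    by (metis mult_div_mod_eq)
qed simp

text \<open>Equal thirds rule out a carry from digit 0, so the quotients by \<open>p\<close> satisfy
  the same divisibilities with one power of \<open>p\<close> less, and induction applies. A carry
  out of digit \<open>n\<close> vanishes modulo \<open>p ^ Suc n\<close>, so thirds are compared
  only below it.\<close>

lemma digits_ap:
  fixes p :: int
  assumes "p > 0" "p ^ Suc n dvd a - 2 * b + c" "p ^ Suc n dvd b - 2 * c + d"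
    and "\<And>i. i < n \<Longrightarrow> 3 * digit p i a div p = 3 * digit p i d div p"
    and "\<And>i. i < n \<Longrightarrow> 3 * digit p i b div p = 3 * digit p i c div p"
    and "i \<le> n"
  shows "p dvd digit p i a - 2 * digit p i b + digit p i c
    \<and> p dvd digit p i b - 2 * digit p i c + digit p i d"
  using assms(2-6)
proof (induction n arbitrary: a b c d i)
  have digit0: "p dvd digit p 0 x - 2 * digit p 0 y + digit p 0 z"
    if "p ^ Suc m dvd x - 2 * y + z" for m x y z
  proof -
    have "p dvd x - 2 * y + z" using that by (auto intro: dvd_mult_left)
    moreover have "[digit p 0 x - 2 * digit p 0 y + digit p 0 z = x - 2 * y + z] (mod p)"
      unfolding digit_def by (intro cong_add cong_diff cong_mult cong_refl) (auto simp: cong_def)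
    ultimately show ?thesis using cong_dvd_iff by blast
  qed
  {
    case 0
    then show ?case using digit0[of 0] by simp
  next
    case (Suc n)
    have ap0: "p dvd digit p 0 a - 2 * digit p 0 b + digit p 0 c"
        "p dvd digit p 0 b - 2 * digit p 0 c + digit p 0 d"
      using digit0 Suc.prems(1,2) by blast+
    show ?case
    proof (cases i)
      case 0
      with ap0 show ?thesis by simp
    next
      case (Suc j)
      have "digit p 0 x \<in> {0..<p}" for x
        using assms(1) by (simp add: digit_def)
      then have no_carry: "digit p 0 a - 2 * digit p 0 b + digit p 0 c = 0"
          "digit p 0 b - 2 * digit p 0 c + digit p 0 d = 0"
        using equal_thirds_no_carry[OF _ _ _ _ ap0] Suc.prems(3,4)[of 0] by auto
      have quotient: "p ^ Suc n dvd x div p - 2 * (y div p) + z div p"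
        if "p ^ Suc (Suc n) dvd x - 2 * y + z"
          and "digit p 0 x - 2 * digit p 0 y + digit p 0 z = 0" for x y z
      proof -
        have "x - 2 * y + z = (p * (x div p) + x mod p) - 2 * (p * (y div p) + y mod p)
            + (p * (z div p) + z mod p)"
          by simp
        also have "\<dots> = p * (x div p - 2 * (y div p) + z div p)"
          using that(2) unfolding digit_def power_0 div_by_1 distrib_left right_diff_distrib
          by linarith
        finally show ?thesis
          using that(1) assms(1) by simp
      qed
      have shift: "digit p k (x div p) = digit p (Suc k) x" for k x
        using assms(1) by (simp add: digit_def zdiv_zmult2_eq)
      show ?thesis
        using Suc.IH[OF quotient[OF Suc.prems(1) no_carry(1)] quotient[OF Suc.prems(2) no_carry(2)], of j]
          Suc.prems(3,4)[of "Suc _"] Suc.prems(5) \<open>i = Suc j\<close>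
        by (simp add: shift)
    qed
  }
qed

section \<open>The norm color on symmetrically colored progressions\<close>

definition norm_color :: "int \<Rightarrow> int \<Rightarrow> int \<Rightarrow> int"
  where "norm_color p k x = cubic_norm k (digit p 0 x) (digit p 1 x) (digit p 2 x) + digit p 3 x"

lemma norm_color_symmetric_imp_eq:
  fixes p :: int
  assumes p: "prime p" "p \<ge> 5" and k: "\<And>t. \<not> p dvd t ^ 3 - t - k"
    and range: "a \<in> {0..<p ^ 4}" "b \<in> {0..<p ^ 4}"
    and ap: "p ^ 4 dvd a - 2 * b + c" "p ^ 4 dvd b - 2 * c + d"
    and thirds: "\<And>i. i < 3 \<Longrightarrow> 3 * digit p i a div p = 3 * digit p i d div p"
      "\<And>i. i < 3 \<Longrightarrow> 3 * digit p i b div p = 3 * digit p i c div p"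
    and norms: "[norm_color p k a = norm_color p k d] (mod p)"
      "[norm_color p k b = norm_color p k c] (mod p)"
  shows "a = b"
proof -
  define D where "D i = digit p i b - digit p i a" for i
  have c: "[digit p i c = digit p i a + 2 * D i] (mod p)"
    and d: "[digit p i d = digit p i a + 3 * D i] (mod p)" if "i \<le> 3" for i
  proof -
    have 1: "p dvd digit p i a - 2 * digit p i b + digit p i c"
      and 2: "p dvd digit p i b - 2 * digit p i c + digit p i d"
      using digits_ap[of p 3 a b c d i] p ap thirds that by (auto simp: numeral_eq_Suc)
    show "[digit p i c = digit p i a + 2 * D i] (mod p)"
      using 1 by (simp add: cong_iff_dvd_diff D_def algebra_simps)
    show "[digit p i d = digit p i a + 3 * D i] (mod p)"
      using dvd_add[OF 2 dvd_mult[OF 1, of 2]] by (simp add: cong_iff_dvd_diff D_def algebra_simps)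
  qed
  define N where "N m = cubic_norm k (digit p 0 a + m * D 0) (digit p 1 a + m * D 1)
    (digit p 2 a + m * D 2)" for m
  have color_b: "norm_color p k b = N 1 + (digit p 3 a + 1 * D 3)"
    by (simp add: norm_color_def N_def D_def)
  have color_a: "norm_color p k a = N 0 + digit p 3 a"
    by (simp add: norm_color_def N_def)
  have color_c: "[norm_color p k c = N 2 + (digit p 3 a + 2 * D 3)] (mod p)"
    unfolding norm_color_def N_def by (intro cong_add[OF cubic_norm_cong] c) auto
  have color_d: "[norm_color p k d = N 3 + (digit p 3 a + 3 * D 3)] (mod p)"
    unfolding norm_color_def N_def by (intro cong_add[OF cubic_norm_cong] d) auto
  have bc: "p dvd N 2 - N 1 + D 3"
    using cong_trans[OF norms(2) color_c] unfolding color_b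
    by (simp add: cong_iff_dvd_diff dvd_diff_commute algebra_simps)
  have ad: "p dvd N 3 - N 0 + 3 * D 3"
    using cong_trans[OF norms(1) color_d] unfolding color_a
    by (simp add: cong_iff_dvd_diff dvd_diff_commute algebra_simps)
  \<comment> \<open>Digit 3 enters linearly, so \<open>D 3\<close> cancels and only the third
    difference of the norm remains.\<close>
  have "N 3 - N 0 + 3 * D 3 - 3 * (N 2 - N 1 + D 3) = 6 * cubic_norm k (D 0) (D 1) (D 2)"
    using cubic_norm_third_difference[of k "digit p 0 a" "D 0" "digit p 1 a" "D 1" "digit p 2 a" "D 2"]
    unfolding N_def by (simp add: algebra_simps)
  then have "p dvd 6 * cubic_norm k (D 0) (D 1) (D 2)"
    using dvd_diff[OF ad dvd_mult[OF bc, of 3]] by simp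
  moreover have "\<not> p dvd 6"
  proof
    assume "p dvd 6"
    then have "p dvd 2 * 3" by simp
    then have "p dvd 2 \<or> p dvd 3" using p(1) prime_dvd_mult_iff by blast
    then show False using p(2) zdvd_imp_le[of p 2] zdvd_imp_le[of p 3] by auto
  qed
  ultimately have "p dvd cubic_norm k (D 0) (D 1) (D 2)"
    using p(1) prime_dvd_mult_iff by blast
  then have D: "p dvd D 0" "p dvd D 1" "p dvd D 2"
    using cubic_norm_anisotropic[OF p(1) k] by blast+
  \<comment> \<open>The norm is now constant along the progression modulo \<open>p\<close>, so
    \<open>bc\<close> reduces to divisibility of \<open>D 3\<close>.\<close>
  have "[N 2 = N 1] (mod p)"
    unfolding N_def using D
    by (intro cubic_norm_cong) (auto simp: cong_iff_dvd_diff algebra_simps)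
  then have "p dvd D 3"
    using bc by (metis cong_iff_dvd_diff dvd_add_right_iff)
  have "digit p i a = digit p i b" if "i < 4" for i
  proof -
    have "i = 0 \<or> i = 1 \<or> i = 2 \<or> i = 3" using that by auto
    then have "p dvd digit p i b - digit p i a"
      using D \<open>p dvd D 3\<close> unfolding D_def by auto
    then have "digit p i b mod p = digit p i a mod p"
      by (simp add: mod_eq_dvd_iff)
    then show ?thesis by (simp add: digit_def)
  qed
  then show ?thesis
    using digits_eq_imp_eq[of p a 4 b] range p by auto
qed

section \<open>Packing the colors into \<open>27 * p\<close> values\<close>

lemma mixed_radix_inject:
  fixes q :: int
  assumes "0 \<le> r" "r < q" "0 \<le> r'" "r' < q" and "r + q * s = r' + q * s'"
  shows "r = r' \<and> s = s'"
proof -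
  have "(r + q * s) mod q = r" "(r + q * s) div q = s"
    "(r' + q * s') mod q = r'" "(r' + q * s') div q = s'"
    using assms(1-4) by auto
  with assms(5) show ?thesis by metis
qed

theorem corollary1p2:
  fixes p :: nat
  assumes "prime p" and "p \<ge> 5"
  shows "\<exists>c :: int \<Rightarrow> nat.
    coloring (27 * p) (carrier (integer_mod_group (p ^ 4))) c \<and>
    \<not> (\<exists>a d. nontrivial_ap (integer_mod_group (p ^ 4)) a d \<and>
             symmetrically_colored (integer_mod_group (p ^ 4)) c a d)"
proof -
  define P where "P = int p"
  define n where "n = P ^ 4"
  have P: "prime P" "P \<ge> 5" using assms by (auto simp: P_def)
  obtain k where k: "\<And>t. \<not> P dvd t ^ 3 - t - k"
    using exists_cubic_without_root_mod[of P] P by auto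
  have n_pos: "n > 0" using P by (simp add: n_def)
  define th where "th i x = 3 * digit P i x div P" for i x
  have th: "0 \<le> th i x" "th i x < 3" for i x
  proof -
    have "0 \<le> digit P i x" "digit P i x < P" using P by (auto simp: digit_def)
    then show "0 \<le> th i x" "th i x < 3"
      using P by (auto simp: th_def pos_imp_zdiv_nonneg_iff div_less_iff_less_mult_int)
  qed
  \<comment> \<open>Mixed radix 3, 3, 3, \<open>P\<close>: three thirds and one residue share a
    single number below \<open>27 * P\<close>, from which each can be recovered.\<close>
  define C where "C x = th 0 x + 3 * (th 1 x + 3 * (th 2 x + 3 * (norm_color P k x mod P)))" for x
  have norm: "0 \<le> norm_color P k x mod P" "norm_color P k x mod P < P" for x
    using P by auto
  have C_range: "0 \<le> C x" "C x < 27 * P" for x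
    using norm[of x] th[of _ x] unfolding C_def by (smt (verit))+
  have C_eqD: "th 0 x = th 0 y \<and> th 1 x = th 1 y \<and> th 2 x = th 2 y
      \<and> [norm_color P k x = norm_color P k y] (mod P)" if "C x = C y" for x y
    using that unfolding C_def cong_def by (meson mixed_radix_inject th)
  have group: "carrier (integer_mod_group (p ^ 4)) = {0..<n}" "\<one>\<^bsub>integer_mod_group (p ^ 4)\<^esub> = 0"
    using assms by (auto simp: carrier_integer_mod_group n_def P_def)
  have ap: "ap_term (integer_mod_group (p ^ 4)) a d i = (a + int i * d) mod n" for a d i
    by (simp add: ap_term_def pow_integer_mod_group mult_integer_mod_group n_def P_def mod_simps)
  have is_coloring: "coloring (27 * p) {0..<n} (\<lambda>x. nat (C x))"
    unfolding coloring_def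
  proof (intro exI conjI)
    show "(\<lambda>x. nat (C x)) \<in> {0..<n} \<rightarrow> {..<27 * p}"
      using C_range by (auto simp: P_def nat_less_iff)
  qed auto
  have no_ap: "d = 0" if a: "a \<in> {0..<n}" and d: "d \<in> {0..<n}"
    and sym: "nat (C (a mod n)) = nat (C ((a + 3 * d) mod n))"
      "nat (C ((a + d) mod n)) = nat (C ((a + 2 * d) mod n))" for a d
  proof -
    define t where "t i = (a + i * d) mod n" for i
    have "C (t 0) = C (t 3)" "C (t 1) = C (t 2)"
      using sym C_range unfolding t_def by (auto simp: eq_nat_nat_iff)
    note colors = this[THEN C_eqD]
    have ap_dvd: "n dvd t i - 2 * t (i + 1) + t (i + 2)" for i
    proof -
      have "[t i - 2 * t (i + 1) + t (i + 2)
          = (a + i * d) - 2 * (a + (i + 1) * d) + (a + (i + 2) * d)] (mod n)"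
        unfolding t_def by (intro cong_add cong_diff cong_mult cong_refl) (auto simp: cong_def)
      then show ?thesis
        by (simp add: cong_0_iff algebra_simps)
    qed
    have "t 0 = t 1"
    proof (rule norm_color_symmetric_imp_eq[OF P k])
      show "t 0 \<in> {0..<P ^ 4}" "t 1 \<in> {0..<P ^ 4}"
        using n_pos by (auto simp: t_def n_def)
      show "P ^ 4 dvd t 0 - 2 * t 1 + t 2" "P ^ 4 dvd t 1 - 2 * t 2 + t 3"
        using ap_dvd[of 0] ap_dvd[of 1] by (simp_all add: n_def)
      show "3 * digit P i (t 0) div P = 3 * digit P i (t 3) div P"
        "3 * digit P i (t 1) div P = 3 * digit P i (t 2) div P" if "i < 3" for i
      proof -
        have "i = 0 \<or> i = 1 \<or> i = 2" using that by auto
        then have "th i (t 0) = th i (t 3)" "th i (t 1) = th i (t 2)"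
          using colors by auto
        then show "3 * digit P i (t 0) div P = 3 * digit P i (t 3) div P"
          "3 * digit P i (t 1) div P = 3 * digit P i (t 2) div P"
          by (simp_all add: th_def)
      qed
    qed (use colors in auto)
    \<comment> \<open>Equality of the first two terms says that \<open>n\<close> divides
      \<open>d\<close>, which lies in \<open>{0..<n}\<close>.\<close>
    then have "n dvd (a + d) - a"
      by (simp add: t_def mod_eq_dvd_iff dvd_diff_commute[of n a])
    then show "d = 0"
      using d by (simp add: dvd_eq_mod_eq_0)
  qed
  show ?thesis
    unfolding nontrivial_ap_def symmetrically_colored_def ap group
  proof (intro exI conjI notI)
    show "coloring (27 * p) {0..<n} (\<lambda>x. nat (C x))" by (fact is_coloring)
  next
    assume "\<exists>a d. (a \<in> {0..<n} \<and> d \<in> {0..<n} \<and> d \<noteq> 0) \<and>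
      nat (C ((a + int 0 * d) mod n)) = nat (C ((a + int 3 * d) mod n)) \<and>
      nat (C ((a + int 1 * d) mod n)) = nat (C ((a + int 2 * d) mod n))"
    then obtain a d where "a \<in> {0..<n}" "d \<in> {0..<n}" "d \<noteq> 0"
      and "nat (C ((a + int 0 * d) mod n)) = nat (C ((a + int 3 * d) mod n))"
      and "nat (C ((a + int 1 * d) mod n)) = nat (C ((a + int 2 * d) mod n))"
      by blast
    then show False using no_ap[of a d] by simp
  qed
qed

end
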